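(* Let the time mesh be uniform with step $\tau>0$, let $\theta\le\frac14$, and let either $\sigma>0$, $\sigma\neq\sigma_0$, or $\sigma=\sigma_0\ge\frac12$. Then the kernel $R=\{R^m\}_{m\ge0}$ of the operator of the discrete transparent boundary condition $$\mathcal S_{\rm ref}^m\boldsymbol\Phi^m=\frac1{2h}\sum_{q=0}^mR^q\Phi^{m-q},\quad m\ge1,$$ is real and is expressed by the explicit formula $$R^m=2a_1\sqrt{\delta}\,\frac1{2m-1}\bigl[p_{m,\alpha,\beta}-\alpha\,p_{m-2,\alpha,\beta}\bigr],\qquad m\ge0,$$ where $$\alpha=\alpha_0\alpha_1,\quad \beta=\frac{\alpha_0+\alpha_1}2,\quad \alpha_0=1-\frac{d_0}{1+\sigma d_0},\quad \alpha_1=1-\frac{d_0(1-4\theta)+d_1}{(1+\sigma d_0)(1-4\theta)+\sigma d_1},$$ $$\delta=(1+\sigma d_0)\bigl[(1+\sigma d_0)(1-4\theta)+\sigma d_1\bigr]>0,\quad d_0=\frac{a_0}{a_1}=\frac{c_\infty}{\rho_\infty}\tau\ge0,\quad d_1=\frac2{a_1}=4\,\frac{b_\infty}{\rho_\infty}\,\frac{\tau}{h^2}>0 .$$ Here, for $\sigma\ne\sigma_0$, the kernel $R$ is the sequence of Taylor coefficients at $z=0$ of $d(z)(\nu_1(z)-\nu_2(z))$. For $\sigma=\sigma_0\ge\frac12$ the assertion means that the discrete transparent boundary condition $$\overset{\circ}{\partial}_x\Bigl[U^{(\sigma)}-\frac{\theta h^2}{b_\infty}\bigl(\rho_\infty\bar\partial_tU+c_\infty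 U^{(\sigma)}\bigr)\Bigr]^m_J=\frac1{2h}\sum_{q=0}^mR^qU_J^{m-q},\quad m\ge1,$$ holds with $R^m=2a_1\sqrt{\delta}\,\frac1{2m-1}\bigl[p_{m,\alpha,\beta}-\alpha\,p_{m-2,\alpha,\beta}\bigr]$, $m\ge0$, for the solution ($U^m\in H_h$ for all $m\ge0$) of the infinite-mesh scheme described in the context.
   Context: Kernel and related quantities. $\rho_\infty>0$, $b_\infty>0$, $c_\infty\ge0$, $h>0$, $\tau>0$; $\sigma,\theta$ real. Put $z^{(\sigma)}=\sigma+(1-\sigma)z$, $a_1=\frac{h^2\rho_\infty}{2\tau b_\infty}>0$, $a_0=\frac{h^2c_\infty}{2b_\infty}\ge0$, $$d(z)=2a_1\theta(z-1)+(1-2a_0\theta)z^{(\sigma)},\qquad \gamma(z)=1+\frac{a_1(1-z)+a_0z^{(\sigma)}}{d(z)}.$$ $\sigma_0:=\frac{2a_1\theta}{1-2a_0\theta}$ is the value of $\sigma$ for which $d(0)=0$; $\sigma\ne\sigma_0$ means $d(0)\ne0$ (automatic if $2a_0\theta=1$). For $\sigma>0$, $\sigma\neq\sigma_0$, $\theta\le\frac14$, $\nu_1(z),\nu_2(z)$ are the roots of $\nu^2-2\gamma(z)\nu+1=0$, analytic near $z=0$, labelled so that $0<|\nu_1(z)|<1<|\nu_2(z)|$. The quantities $p_{m,\alpha,\beta}$ are defined by $$p_{m,\alpha,\beta}=\frac{2m-1}m\,\beta\,p_{m-1,\alpha,\beta}-\frac{m-1}m\,\alpha\,p_{m-2,\alpha,\beta}\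 (m\ge1),\qquad p_{0,\alpha,\beta}=1,\qquad p_{m,\alpha,\beta}=0\ (m<0).$$ Infinite-mesh scheme. $\rho,b,c$ are continuous with $\rho(x)\ge\underline\rho>0$, $b(x)\ge\nu>0$ ($\nu$ a constant), $c(x)\ge0$ for $x>0$, and $\rho=\rho_\infty$, $b=b_\infty$, $c=c_\infty$ for $x\ge X_0>0$; $X>X_0$. The mesh $\bar\omega_{h,\infty}$ has nodes $0=x_0<x_1<\dots<x_J=X<\dots$, $h_j=x_j-x_{j-1}$, $h_J\le X-X_0$, $h_j=h=h_J$ for $j\ge J$, $x_{j-1/2}=\frac{x_{j-1}+x_j}2$, $h_{j+1/2}=\frac{h_j+h_{j+1}}2$; $t_m=m\tau$. $\rho_{hj}=\rho(x_{j-1/2})$, $b_{hj}=b(x_{j-1/2})$, $c_{hj}=c(x_{j-1/2})$. Operators: $\bar\partial_xW_j=\frac{W_j-W_{j-1}}{h_j}$, $\widehat\partial_xW_j=\frac{W_{j+1}-W_j}{h_{j+1/2}}$, $\overset{\circ}{\partial}_xW_j=\frac{W_{j+1}-W_{j-1}}{2h_{j+1/2}}$, $\widehat s_xW_j=\frac{h_j}{2h_{j+1/2}}W_j+\frac{h_{j+1}}{2h_{j+1/2}}W_{j+1}$, $C_\theta[\varkappa_h]W_j=\theta\frac{h_j}{h_{j+1/2}}\varkappa_{hj}W_{j-1}+(1-2\theta)(\widehat s_x\varkappa_{hj})W_j+\theta\frac{h_{j+1}}{h_{j+1/2}}\varkappa_{h,j+1}W_{j+1}$, $\mathcal A_hW=-\widehat\partial_x(b_h\bar\partial_xW)+C_\theta[c_h]W$,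 $\bar\partial_t\Phi^m=\frac{\Phi^m-\Phi^{m-1}}\tau$, $\Phi^{(\sigma)\,m}=\sigma\Phi^m+(1-\sigma)\Phi^{m-1}$. $H_h$ is the space of real functions $W$ on $\bar\omega_{h,\infty}$ with $W_0=0$ and $\sum_{j\ge1}W_j^2<\infty$. The scheme is $$C_\theta[\rho_h]\bar\partial_tU^m+\mathcal A_hU^{(\sigma)\,m}=F^m\ \text{at } x_j,\ j\ge1,\ m\ge1;\quad U^m_0=0,\ m\ge1;\quad U^0=U^0_h,$$ with $F^m_j=0$ for $j\ge J$, $m\ge1$, and $U^0_{h}\in H_h$, $U^0_{hj}=0$ for $j\ge J-1$. By definition, the discrete transparent boundary condition is the condition $\overset{\circ}{\partial}_x\bigl[U^{(\sigma)}-\frac{\theta h^2}{b_\infty}(\rho_\infty\bar\partial_tU+c_\infty U^{(\sigma)})\bigr]^m_J=\mathcal S_{\rm ref}^m\mathbf U_J^m$, $m\ge1$, satisfied by the solution of this scheme, where $\mathbf U_J^m=\{U_J^0,\dots,U_J^m\}$. *)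

theory Defs
  imports "HOL-Complex_Analysis.Complex_Analysis"
begin

definition z_sig :: "real \<Rightarrow> complex \<Rightarrow> complex" where
  "z_sig \<sigma> z = of_real \<sigma> + of_real (1 - \<sigma>) * z"

(* The critical value of \<sigma> is \<sigma>0 = 2 * a1 * \<theta> / (1 - 2 * a0 * \<theta>).  With x / 0 = 0 it is 0 if
   2 * a0 * \<theta> = 1; hence, for \<sigma> > 0 and a1 > 0, \<sigma> \<noteq> \<sigma>0 is equivalent to d(0) \<noteq> 0 in all cases. *)
definition d_fun :: "real \<Rightarrow> real \<Rightarrow> real \<Rightarrow> real \<Rightarrow> complex \<Rightarrow> complex" where
  "d_fun a0 a1 \<sigma> \<theta> z =
     of_real (2 * a1 * \<theta>) * (z - 1) + of_real (1 - 2 * a0 * \<theta>) * z_sig \<sigma> z"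

definition gamma_fun :: "real \<Rightarrow> real \<Rightarrow> real \<Rightarrow> real \<Rightarrow> complex \<Rightarrow> complex" where
  "gamma_fun a0 a1 \<sigma> \<theta> z =
     1 + (of_real a1 * (1 - z) + of_real a0 * z_sig \<sigma> z) / d_fun a0 a1 \<sigma> \<theta> z"

(* The labelling by modulus determines both functions on a neighbourhood of 0. *)
definition char_roots ::
  "real \<Rightarrow> real \<Rightarrow> real \<Rightarrow> real \<Rightarrow> (complex \<Rightarrow> complex) \<Rightarrow> (complex \<Rightarrow> complex) \<Rightarrow> bool" where
  "char_roots a0 a1 \<sigma> \<theta> \<nu>1 \<nu>2 \<longleftrightarrow>
     \<nu>1 analytic_on {0} \<and> \<nu>2 analytic_on {0} \<and>
     (\<forall>\<^sub>F z in nhds 0.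
        (\<nu>1 z)\<^sup>2 - 2 * gamma_fun a0 a1 \<sigma> \<theta> z * \<nu>1 z + 1 = 0 \<and>
        (\<nu>2 z)\<^sup>2 - 2 * gamma_fun a0 a1 \<sigma> \<theta> z * \<nu>2 z + 1 = 0 \<and>
        0 < norm (\<nu>1 z) \<and> norm (\<nu>1 z) < 1 \<and> 1 < norm (\<nu>2 z))"

(* The index is an integer, so that indices -2 and -1 (for m = 0, 1) are available. *)
function p_seq :: "real \<Rightarrow> real \<Rightarrow> int \<Rightarrow> real" where
  "p_seq \<alpha> \<beta> m =
     (if m < 0 then 0
      else if m = 0 then 1
      else (2 * of_int m - 1) / of_int m * \<beta> * p_seq \<alpha> \<beta> (m - 1)
         - (of_int m - 1) / of_int m * \<alpha> * p_seq \<alpha> \<beta> (m - 2))"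
  by pat_completeness auto
termination
  by (relation "Wellfounded.measure (\<lambda>(\<alpha>, \<beta>, m). nat m)") auto

declare p_seq.simps [simp del]

definition ref_kernel :: "real \<Rightarrow> real \<Rightarrow> real \<Rightarrow> real \<Rightarrow> nat \<Rightarrow> real" where
  "ref_kernel a1 \<alpha> \<beta> \<delta> m =
     2 * a1 * sqrt \<delta> * (1 / (2 * real m - 1)) *
     (p_seq \<alpha> \<beta> (int m) - \<alpha> * p_seq \<alpha> \<beta> (int m - 2))"

definition S_ref :: "real \<Rightarrow> (nat \<Rightarrow> real) \<Rightarrow> nat \<Rightarrow> (nat \<Rightarrow> real) \<Rightarrow> real" where
  "S_ref h R m \<Phi> = 1 / (2 * h) * (\<Sum>q\<le>m. R q * \<Phi> (m - q))"


(* A mesh is the sequence x of its nodes, and a mesh function is a sequence W with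
   W j its value at x j.  A time-dependent mesh function U has U m j as its value at
   time level m and node j.  Step sizes, midpoints and backward differences are used
   only at j \<ge> 1 (m \<ge> 1 in time). *)

definition mesh_step :: "(nat \<Rightarrow> real) \<Rightarrow> nat \<Rightarrow> real" where
  "mesh_step x j = x j - x (j - 1)"

(* h_{j+1/2} *)
definition mesh_half_step :: "(nat \<Rightarrow> real) \<Rightarrow> nat \<Rightarrow> real" where
  "mesh_half_step x j = (mesh_step x j + mesh_step x (j + 1)) / 2"

(* f at x_{j-1/2} *)
definition mesh_coeff :: "(nat \<Rightarrow> real) \<Rightarrow> (real \<Rightarrow> real) \<Rightarrow> nat \<Rightarrow> real" where
  "mesh_coeff x f j = f ((x (j - 1) + x j) / 2)"

definition dx_bar :: "(nat \<Rightarrow> real) \<Rightarrow> (nat \<Rightarrow> real) \<Rightarrow> nat \<Rightarrow> real" where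
  "dx_bar x W j = (W j - W (j - 1)) / mesh_step x j"

definition dx_hat :: "(nat \<Rightarrow> real) \<Rightarrow> (nat \<Rightarrow> real) \<Rightarrow> nat \<Rightarrow> real" where
  "dx_hat x W j = (W (j + 1) - W j) / mesh_half_step x j"

definition dx_circ :: "(nat \<Rightarrow> real) \<Rightarrow> (nat \<Rightarrow> real) \<Rightarrow> nat \<Rightarrow> real" where
  "dx_circ x W j = (W (j + 1) - W (j - 1)) / (2 * mesh_half_step x j)"

definition sx_hat :: "(nat \<Rightarrow> real) \<Rightarrow> (nat \<Rightarrow> real) \<Rightarrow> nat \<Rightarrow> real" where
  "sx_hat x W j =
     mesh_step x j / (2 * mesh_half_step x j) * W j +
     mesh_step x (j + 1) / (2 * mesh_half_step x j) * W (j + 1)"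

definition C_op :: "(nat \<Rightarrow> real) \<Rightarrow> real \<Rightarrow> (nat \<Rightarrow> real) \<Rightarrow> (nat \<Rightarrow> real) \<Rightarrow> nat \<Rightarrow> real" where
  "C_op x \<theta> \<kappa> W j =
     \<theta> * (mesh_step x j / mesh_half_step x j) * \<kappa> j * W (j - 1) +
     (1 - 2 * \<theta>) * sx_hat x \<kappa> j * W j +
     \<theta> * (mesh_step x (j + 1) / mesh_half_step x j) * \<kappa> (j + 1) * W (j + 1)"

definition A_op ::
  "(nat \<Rightarrow> real) \<Rightarrow> real \<Rightarrow> (nat \<Rightarrow> real) \<Rightarrow> (nat \<Rightarrow> real) \<Rightarrow> (nat \<Rightarrow> real) \<Rightarrow> nat \<Rightarrow> real" where
  "A_op x \<theta> bh ch W j = - dx_hat x (\<lambda>i. bh i * dx_bar x W i) j + C_op x \<theta> ch W j"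

definition dt_bar :: "real \<Rightarrow> (nat \<Rightarrow> nat \<Rightarrow> real) \<Rightarrow> nat \<Rightarrow> nat \<Rightarrow> real" where
  "dt_bar \<tau> U m j = (U m j - U (m - 1) j) / \<tau>"

definition t_avg :: "real \<Rightarrow> (nat \<Rightarrow> nat \<Rightarrow> real) \<Rightarrow> nat \<Rightarrow> nat \<Rightarrow> real" where
  "t_avg \<sigma> U m j = \<sigma> * U m j + (1 - \<sigma>) * U (m - 1) j"

definition H_space :: "(nat \<Rightarrow> real) set" where
  "H_space = {W. W 0 = 0 \<and> summable (\<lambda>j. (W j)\<^sup>2)}"

definition admissible_coeffs ::
  "real \<Rightarrow> real \<Rightarrow> real \<Rightarrow> real \<Rightarrow> (real \<Rightarrow> real) \<Rightarrow> (real \<Rightarrow> real) \<Rightarrow> (real \<Rightarrow> real) \<Rightarrow> bool" where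
  "admissible_coeffs \<rho>_inf b_inf c_inf X0 \<rho> b c \<longleftrightarrow>
     continuous_on {0<..} \<rho> \<and> continuous_on {0<..} b \<and> continuous_on {0<..} c \<and>
     (\<exists>\<rho>low>0. \<forall>x>0. \<rho>low \<le> \<rho> x) \<and> (\<exists>\<nu>>0. \<forall>x>0. \<nu> \<le> b x) \<and> (\<forall>x>0. 0 \<le> c x) \<and>
     (\<forall>x\<ge>X0. \<rho> x = \<rho>_inf \<and> b x = b_inf \<and> c x = c_inf)"

definition admissible_mesh ::
  "real \<Rightarrow> real \<Rightarrow> real \<Rightarrow> (nat \<Rightarrow> real) \<Rightarrow> nat \<Rightarrow> bool" where
  "admissible_mesh h X0 X x J \<longleftrightarrow>
     x 0 = 0 \<and> strict_mono x \<and> x J = X \<and>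
     mesh_step x J \<le> X - X0 \<and> (\<forall>j\<ge>J. mesh_step x j = h)"

definition scheme_solution ::
  "(nat \<Rightarrow> real) \<Rightarrow> nat \<Rightarrow> real \<Rightarrow> real \<Rightarrow> real \<Rightarrow> (real \<Rightarrow> real) \<Rightarrow> (real \<Rightarrow> real) \<Rightarrow> (real \<Rightarrow> real) \<Rightarrow>
   (nat \<Rightarrow> nat \<Rightarrow> real) \<Rightarrow> (nat \<Rightarrow> real) \<Rightarrow> (nat \<Rightarrow> nat \<Rightarrow> real) \<Rightarrow> bool" where
  "scheme_solution x J \<tau> \<sigma> \<theta> \<rho> b c F U0 U \<longleftrightarrow>
     (\<forall>m\<ge>1. \<forall>j\<ge>J. F m j = 0) \<and>
     U0 \<in> H_space \<and> (\<forall>j\<ge>J - 1. U0 j = 0) \<and>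
     (\<forall>m. U m \<in> H_space) \<and>
     (\<forall>m\<ge>1. \<forall>j\<ge>1.
        C_op x \<theta> (mesh_coeff x \<rho>) (dt_bar \<tau> U m) j +
        A_op x \<theta> (mesh_coeff x b) (mesh_coeff x c) (t_avg \<sigma> U m) j = F m j) \<and>
     (\<forall>m\<ge>1. U m 0 = 0) \<and> U 0 = U0"

end

theory Submission
  imports Defs
begin

(* Frees the infix $ for the coefficients of power series. *)
unbundle no vec_syntax

text \<open>
  Write \<open>n(z) = a1 (1 - z) + a0 z\<^bsup>(\<sigma>)\<^esup>\<close> for the numerator in \<open>\<gamma> = 1 + n/d\<close>. Both \<open>n\<close> and
  \<open>n + 2 d\<close> are affine in \<open>z\<close>, proportional to \<open>1 - \<alpha>0 z\<close> and \<open>1 - \<alpha>1 z\<close>, and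
  \<open>n (n + 2 d) = a1\<^sup>2 \<delta> (1 - 2 \<beta> z + \<alpha> z\<^sup>2)\<close>. By Vieta the two roots satisfy
  \<open>(d (\<nu>1 - \<nu>2))\<^sup>2 = 4 d\<^sup>2 (\<gamma>\<^sup>2 - 1) = 4 n (n + 2 d)\<close>, so up to a sign \<open>d (\<nu>1 - \<nu>2)\<close> is
  \<open>2 a1 \<surd>\<delta> \<surd>(1 - 2 \<beta> z + \<alpha> z\<^sup>2)\<close>.

  The numbers \<open>p\<^sub>m\<close> obey a rescaled Legendre recurrence, and their generating function \<open>P\<close> solves
  the differential equation of \<open>w powr (-1/2)\<close> for \<open>w = 1 - 2 \<beta> z + \<alpha> z\<^sup>2\<close>. Hence \<open>w P\<^sup>2 = 1\<close>
  (\<open>quad_fps_mult_legendre_fps_square\<close>), and \<open>w P\<close> is the square root of \<open>w\<close>. The recurrence turns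
  the coefficients of \<open>w P\<close> into \<open>- (p\<^sub>m - \<alpha> p\<^sub>m\<^sub>-\<^sub>2) / (2 m - 1)\<close>, so that the series \<open>K\<close> of the
  kernel satisfies \<open>K\<^sup>2 = 4 n (n + 2 d)\<close> with \<open>K(0) < 0\<close>.

  If \<open>d(0) \<noteq> 0\<close>, then formal power series over a field being an integral domain, the Taylor series of
  \<open>d (\<nu>1 - \<nu>2)\<close> is \<open>K\<close> or \<open>- K\<close>. At \<open>z = 0\<close> everything is real, and the labelling
  \<open>\<bar>\<nu>1\<bar> < \<bar>\<nu>2\<bar>\<close> selects the negative value (\<open>char_roots_expansion\<close>).

  If \<open>\<sigma> = \<sigma>0\<close>, then \<open>d(0) = 0\<close> and \<open>\<nu>2\<close> has a pole at \<open>0\<close>, so the argument is carried out with the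
  formal generating series \<open>V\<^sub>j\<close> in time of the solution at the nodes. Where the coefficients are
  constant these satisfy \<open>d V\<^sub>j\<^sub>+\<^sub>1 - 2 (d + n) V\<^sub>j + d V\<^sub>j\<^sub>-\<^sub>1 = 0\<close>, and there is a formal root \<open>\<nu>\<close>
  with \<open>\<nu>(0) = 0\<close>. The defect \<open>e\<^sub>j = V\<^sub>j\<^sub>+\<^sub>1 - \<nu> V\<^sub>j\<close> obeys \<open>e\<^sub>j = \<nu> e\<^sub>j\<^sub>+\<^sub>1\<close>, so it is divisible by every
  power of \<open>z\<close> and vanishes. Thus \<open>V\<^sub>j\<^sub>+\<^sub>1 = \<nu> V\<^sub>j\<close>, which yields
  \<open>d (V\<^sub>J\<^sub>+\<^sub>1 - V\<^sub>J\<^sub>-\<^sub>1) = K V\<^sub>J\<close> (\<open>transparent_relation_fps\<close>); its coefficients are the asserted boundary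
  condition. At \<open>\<sigma> = \<sigma>0\<close> the new time level enters the far-field scheme only through the diagonal, and
  this finite speed of propagation is what the divisibility argument expresses.
\<close>


section \<open>The generating series of the kernel\<close>

lemma p_seq_neg: "m < 0 \<Longrightarrow> p_seq \<alpha> \<beta> m = 0"
  by (simp add: p_seq.simps)

lemma p_seq_0: "p_seq \<alpha> \<beta> 0 = 1"
  by (simp add: p_seq.simps)

lemma p_seq_recurrence:
  assumes "m > 0"
  shows "of_int m * p_seq \<alpha> \<beta> m
       = (2 * of_int m - 1) * \<beta> * p_seq \<alpha> \<beta> (m - 1)
         - (of_int m - 1) * \<alpha> * p_seq \<alpha> \<beta> (m - 2)"
proof -
  have "of_int m \<noteq> (0::real)"
    using assms by simp
  then show ?thesis
    using assms by (subst p_seq.simps) (simp add: right_diff_distrib)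
qed

definition legendre_fps :: "real \<Rightarrow> real \<Rightarrow> 'a::real_field fps" where
  "legendre_fps \<alpha> \<beta> = Abs_fps (\<lambda>m. of_real (p_seq \<alpha> \<beta> (int m)))"

definition kernel_fps :: "real \<Rightarrow> real \<Rightarrow> real \<Rightarrow> real \<Rightarrow> 'a::real_field fps" where
  "kernel_fps a1 \<alpha> \<beta> \<delta> = Abs_fps (\<lambda>m. of_real (ref_kernel a1 \<alpha> \<beta> \<delta> m))"

definition lin_fps :: "real \<Rightarrow> real \<Rightarrow> 'a::real_field fps" where
  "lin_fps u v = fps_const (of_real u) + fps_const (of_real v) * fps_X"

definition quad_fps :: "real \<Rightarrow> real \<Rightarrow> 'a::real_field fps" where
  "quad_fps \<alpha> \<beta> =
     1 - fps_const (of_real (2 * \<beta>)) * fps_X + fps_const (of_real \<alpha>) * (fps_X * fps_X)"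

lemma lin_fps_mult_nth:
  "(lin_fps u v * F) $ m = of_real u * F $ m + (if m = 0 then 0 else of_real v * F $ (m - 1))"
  by (simp add: lin_fps_def distrib_right mult.assoc)

lemma lin_fps_nth_0: "lin_fps u v $ 0 = of_real u"
  by (simp add: lin_fps_def)

lemma quad_fps_mult_nth:
  "(quad_fps \<alpha> \<beta> * F) $ m
     = F $ m - (if m = 0 then 0 else of_real (2 * \<beta>) * F $ (m - 1))
         + (if m < 2 then 0 else of_real \<alpha> * F $ (m - 2))"
  by (simp add: quad_fps_def left_diff_distrib distrib_right mult.assoc numeral_2_eq_2)

lemma quad_fps_nth_0_1: "quad_fps \<alpha> \<beta> $ 0 = 1" "quad_fps \<alpha> \<beta> $ Suc 0 = - of_real (2 * \<beta>)"
  by (simp_all add: quad_fps_def)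

text \<open>
  The differential equation of \<open>w powr (-1/2)\<close>, whose right-hand side is \<open>- w' / 2\<close> times the
  series; comparing coefficients, it is the recurrence of \<open>p\<^sub>m\<close>.
\<close>

lemma legendre_fps_ode:
  "quad_fps \<alpha> \<beta> * fps_deriv (legendre_fps \<alpha> \<beta>) = lin_fps \<beta> (- \<alpha>) * (legendre_fps \<alpha> \<beta> :: 'a::real_field fps)"
proof (rule fps_ext)
  fix m :: nat
  let ?p = "\<lambda>k. p_seq \<alpha> \<beta> k"
  have real_identity:
    "(real m + 1) * ?p (int m + 1) - 2 * \<beta> * (real m * ?p (int m)) + \<alpha> * ((real m - 1) * ?p (int m - 1))
       = \<beta> * ?p (int m) - \<alpha> * ?p (int m - 1)"
    using p_seq_recurrence[of "int m + 1" \<alpha> \<beta>] by (simp add: algebra_simps)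
  have lhs: "(quad_fps \<alpha> \<beta> * fps_deriv (legendre_fps \<alpha> \<beta>)) $ m =
      (of_real ((real m + 1) * ?p (int m + 1) - 2 * \<beta> * (real m * ?p (int m))
        + \<alpha> * ((real m - 1) * ?p (int m - 1))) :: 'a)"
  proof (cases "m < 2")
    case True
    then consider "m = 0" | "m = 1" by linarith
    then show ?thesis
      by cases (simp_all add: quad_fps_nth_0_1 legendre_fps_def p_seq_neg)
  next
    case False
    then obtain k where "m = Suc (Suc k)"
      by (metis add_2_eq_Suc le_Suc_ex not_less)
    then show ?thesis
      by (simp add: quad_fps_mult_nth legendre_fps_def algebra_simps)
  qed
  have rhs: "(lin_fps \<beta> (- \<alpha>) * legendre_fps \<alpha> \<beta>) $ m =
      (of_real (\<beta> * ?p (int m) - \<alpha> * ?p (int m - 1)) :: 'a)"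
    by (cases m) (simp_all add: lin_fps_mult_nth lin_fps_nth_0 legendre_fps_def p_seq_neg)
  show "(quad_fps \<alpha> \<beta> * fps_deriv (legendre_fps \<alpha> \<beta>)) $ m
      = (lin_fps \<beta> (- \<alpha>) * (legendre_fps \<alpha> \<beta> :: 'a fps)) $ m"
    unfolding lhs rhs real_identity ..
qed

text \<open>
  By the differential equation, \<open>w P\<^sup>2\<close> has derivative \<open>0\<close>, so it equals its constant term.
\<close>

lemma quad_fps_mult_legendre_fps_square:
  "quad_fps \<alpha> \<beta> * (legendre_fps \<alpha> \<beta> * legendre_fps \<alpha> \<beta>) = (1 :: 'a::real_field fps)"
proof -
  let ?P = "legendre_fps \<alpha> \<beta> :: 'a fps" and ?w = "quad_fps \<alpha> \<beta> :: 'a fps"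
  have dw: "fps_deriv ?w = - 2 * lin_fps \<beta> (- \<alpha>)"
  proof -
    have "fps_const (of_real (2 * \<beta>)) = 2 * (fps_const (of_real \<beta>) :: 'a fps)"
      by (simp add: numeral_fps_const)
    then show ?thesis
      by (simp add: quad_fps_def lin_fps_def algebra_simps del: fps_const_mult flip: fps_const_neg)
  qed
  have "fps_deriv (?w * (?P * ?P)) = fps_deriv ?w * (?P * ?P) + 2 * ?P * (?w * fps_deriv ?P)"
    by (simp add: algebra_simps)
  also have "\<dots> = 0"
    unfolding dw legendre_fps_ode by (simp add: algebra_simps)
  finally have "?w * (?P * ?P) = fps_const ((?w * (?P * ?P)) $ 0)"
    by (rule fps_deriv_eq_0_iff[THEN iffD1])
  also have "(?w * (?P * ?P)) $ 0 = 1"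
    by (simp add: quad_fps_nth_0_1 legendre_fps_def p_seq_0)
  finally show ?thesis by simp
qed

text \<open>
  The factor \<open>1 / (2 m - 1)\<close> arises by eliminating \<open>p\<^sub>m\<^sub>-\<^sub>1\<close> from the three-term coefficient of \<open>w P\<close>
  with the help of the recurrence. As \<open>w P\<^sup>2 = 1\<close>, the series \<open>w P\<close> is a square root of \<open>w\<close>.
\<close>

lemma kernel_fps_eq:
  "kernel_fps a1 \<alpha> \<beta> \<delta>
     = fps_const (- of_real (2 * a1 * sqrt \<delta>)) * (quad_fps \<alpha> \<beta> * legendre_fps \<alpha> \<beta>)"
proof (rule fps_ext)
  fix m :: nat
  let ?p = "\<lambda>k. p_seq \<alpha> \<beta> k"
  have real_identity:
    "1 / (2 * real m - 1) * (?p (int m) - \<alpha> * ?p (int m - 2))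
       = - (?p (int m) - 2 * \<beta> * ?p (int m - 1) + \<alpha> * ?p (int m - 2))"
  proof (cases "m = 0")
    case True
    then show ?thesis by (simp add: p_seq_neg)
  next
    case False
    then have "2 * real m - 1 \<noteq> 0" by simp
    moreover have "real m * ?p (int m)
        = (2 * real m - 1) * \<beta> * ?p (int m - 1) - (real m - 1) * \<alpha> * ?p (int m - 2)"
      using p_seq_recurrence[of "int m" \<alpha> \<beta>] False by simp
    ultimately show ?thesis
      by (simp add: divide_simps) (simp add: algebra_simps)
  qed
  have "kernel_fps a1 \<alpha> \<beta> \<delta> $ m
      = of_real (2 * a1 * sqrt \<delta> * (1 / (2 * real m - 1) * (?p (int m) - \<alpha> * ?p (int m - 2))))"
    by (simp only: kernel_fps_def ref_kernel_def fps_nth_Abs_fps mult.assoc)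
  also have "\<dots> = - of_real (2 * a1 * sqrt \<delta>)
      * of_real (?p (int m) - 2 * \<beta> * ?p (int m - 1) + \<alpha> * ?p (int m - 2))"
    unfolding real_identity by (simp only: of_real_mult of_real_minus mult_minus_left mult_minus_right)
  also have "of_real (?p (int m) - 2 * \<beta> * ?p (int m - 1) + \<alpha> * ?p (int m - 2))
      = (quad_fps \<alpha> \<beta> * legendre_fps \<alpha> \<beta>) $ m"
    by (simp add: quad_fps_mult_nth legendre_fps_def p_seq_neg of_nat_diff)
  finally show "kernel_fps a1 \<alpha> \<beta> \<delta> $ m
      = (fps_const (- of_real (2 * a1 * sqrt \<delta>)) * (quad_fps \<alpha> \<beta> * legendre_fps \<alpha> \<beta>)) $ m"
    by (simp only: fps_mult_left_const_nth)
qed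

lemma kernel_fps_nth_0: "kernel_fps a1 \<alpha> \<beta> \<delta> $ 0 = - of_real (2 * a1 * sqrt \<delta>)"
  by (simp add: kernel_fps_def ref_kernel_def p_seq_0 p_seq_neg)

lemma kernel_fps_square:
  assumes "\<delta> \<ge> 0"
  shows "kernel_fps a1 \<alpha> \<beta> \<delta> * kernel_fps a1 \<alpha> \<beta> \<delta>
    = fps_const (of_real (4 * a1\<^sup>2 * \<delta>)) * (quad_fps \<alpha> \<beta> :: 'a::real_field fps)"
proof -
  let ?c = "fps_const (of_real (2 * a1 * sqrt \<delta>)) :: 'a fps"
    and ?P = "legendre_fps \<alpha> \<beta> :: 'a fps" and ?w = "quad_fps \<alpha> \<beta> :: 'a fps"
  have "kernel_fps a1 \<alpha> \<beta> \<delta> * kernel_fps a1 \<alpha> \<beta> \<delta> = ?c * ?c * ?w * (?w * (?P * ?P))"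
    unfolding kernel_fps_eq by (simp add: algebra_simps del: fps_const_mult flip: fps_const_neg)
  also have "\<dots> = ?c * ?c * ?w"
    unfolding quad_fps_mult_legendre_fps_square by simp
  also have "?c * ?c = fps_const (of_real (4 * a1\<^sup>2 * \<delta>))"
  proof -
    have "(2 * a1 * sqrt \<delta>) * (2 * a1 * sqrt \<delta>) = 4 * a1\<^sup>2 * \<delta>"
      using assms by (simp add: power2_eq_square)
    then show ?thesis
      by (simp flip: of_real_mult)
  qed
  finally show ?thesis .
qed

section \<open>The symbol and its characteristic roots\<close>

text \<open>
  Here \<open>n0 + n1 z\<close> is the numerator \<open>n\<close> of \<open>\<gamma> - 1\<close> and \<open>D0 + D1 z\<close> the denominator \<open>d\<close>. The last three
  assumptions are \<open>n (n + 2 d) = a1\<^sup>2 \<delta> (1 - 2 \<beta> z + \<alpha> z\<^sup>2)\<close>, coefficient by coefficient, which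
  makes the factorisation usable both for numbers \<open>z\<close> and for formal power series.
\<close>

locale factored_symbol =
  fixes n0 n1 D0 D1 a1 \<alpha> \<beta> \<delta> :: real
  assumes a1_pos: "a1 > 0"
    and delta_pos: "\<delta> > 0"
    and n0_pos: "n0 > 0"
    and n0_2D0_pos: "n0 + 2 * D0 > 0"
    and coeff_0: "n0 * (n0 + 2 * D0) = a1\<^sup>2 * \<delta>"
    and coeff_1: "n0 * (n1 + 2 * D1) + n1 * (n0 + 2 * D0) = - 2 * \<beta> * (a1\<^sup>2 * \<delta>)"
    and coeff_2: "n1 * (n1 + 2 * D1) = \<alpha> * (a1\<^sup>2 * \<delta>)"
begin

lemma sqrt_delta_pos: "a1 * sqrt \<delta> > 0"
  using a1_pos delta_pos by simp

lemma kernel_fps_square_symbol: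
  "kernel_fps a1 \<alpha> \<beta> \<delta> * kernel_fps a1 \<alpha> \<beta> \<delta>
     = 4 * lin_fps n0 n1 * (lin_fps n0 n1 + 2 * (lin_fps D0 D1 :: 'a::real_field fps))"
proof -
  have sum: "lin_fps n0 n1 + 2 * lin_fps D0 D1 = (lin_fps (n0 + 2 * D0) (n1 + 2 * D1) :: 'a fps)"
    by (rule fps_ext) (simp add: lin_fps_def fps_X_def numeral_fps_const)
  have "lin_fps n0 n1 * (lin_fps (n0 + 2 * D0) (n1 + 2 * D1) :: 'a fps)
      = fps_const (of_real (n0 * (n0 + 2 * D0)))
        + fps_const (of_real (n0 * (n1 + 2 * D1) + n1 * (n0 + 2 * D0))) * fps_X
        + fps_const (of_real (n1 * (n1 + 2 * D1))) * (fps_X * fps_X)"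
    by (simp add: lin_fps_def algebra_simps flip: fps_const_mult fps_const_add)
  also have "\<dots> = fps_const (of_real (a1\<^sup>2 * \<delta>)) * quad_fps \<alpha> \<beta>"
    unfolding coeff_0 coeff_1 coeff_2 quad_fps_def
    by (simp add: algebra_simps flip: fps_const_mult fps_const_neg)
  finally have prod: "lin_fps n0 n1 * (lin_fps (n0 + 2 * D0) (n1 + 2 * D1) :: 'a fps)
      = fps_const (of_real (a1\<^sup>2 * \<delta>)) * quad_fps \<alpha> \<beta>" .
  have four: "fps_const (of_real (4 * a1\<^sup>2 * \<delta>)) = 4 * (fps_const (of_real (a1\<^sup>2 * \<delta>)) :: 'a fps)"
    by (simp add: numeral_fps_const mult.assoc)
  have "kernel_fps a1 \<alpha> \<beta> \<delta> * kernel_fps a1 \<alpha> \<beta> \<delta> = 4 * fps_const (of_real (a1\<^sup>2 * \<delta>)) * (quad_fps \<alpha> \<beta> :: 'a fps)"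
    by (simp only: kernel_fps_square[OF less_imp_le[OF delta_pos]] four)
  then show ?thesis
    by (simp only: sum mult.assoc prod)
qed

lemma symbol_factorisation:
  fixes z :: "'a::real_field"
  shows "(of_real n0 + of_real n1 * z) * ((of_real n0 + of_real n1 * z) + 2 * (of_real D0 + of_real D1 * z))
    = of_real (a1\<^sup>2 * \<delta>) * (1 - of_real (2 * \<beta>) * z + of_real \<alpha> * (z * z))"
proof -
  have "(of_real n0 + of_real n1 * z) * ((of_real n0 + of_real n1 * z) + 2 * (of_real D0 + of_real D1 * z))
     = of_real (n0 * (n0 + 2 * D0)) + of_real (n0 * (n1 + 2 * D1) + n1 * (n0 + 2 * D0)) * z
       + of_real (n1 * (n1 + 2 * D1)) * (z * z)"
    by (simp add: algebra_simps)
  also have "\<dots> = of_real (a1\<^sup>2 * \<delta>) * (1 - of_real (2 * \<beta>) * z + of_real \<alpha> * (z * z))"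
    unfolding coeff_0 coeff_1 coeff_2 by (simp add: algebra_simps)
  finally show ?thesis .
qed

definition numer :: "complex \<Rightarrow> complex" where
  "numer z = of_real n0 + of_real n1 * z"

definition denom :: "complex \<Rightarrow> complex" where
  "denom z = of_real D0 + of_real D1 * z"

definition gam :: "complex \<Rightarrow> complex" where
  "gam z = 1 + numer z / denom z"

lemma denom_eventually_nonzero:
  assumes "D0 \<noteq> 0"
  shows "\<forall>\<^sub>F z in nhds 0. denom z \<noteq> 0"
proof -
  have "open {z. denom z \<noteq> 0}"
    unfolding denom_def by (intro open_Collect_neq continuous_intros)
  then show ?thesis
    using eventually_nhds_in_open[of "{z. denom z \<noteq> 0}" 0] assms by (simp add: denom_def)
qed

text \<open>
  The Taylor series \<open>F\<close> of \<open>d (\<nu>1 - \<nu>2)\<close> has the same square as the kernel series \<open>K\<close>. Only the sign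
  at \<open>z = 0\<close> remains, and there \<open>d \<nu>1\<close> and \<open>d \<nu>2\<close> are the real numbers \<open>d + n \<plusminus> a1 \<surd>\<delta>\<close>.
  Since \<open>2 (d + n) = n + (n + 2 d) > 0\<close>, the one of smaller modulus carries the minus sign,
  whatever the sign of \<open>d(0)\<close>.
\<close>

lemma char_roots_expansion:
  assumes "D0 \<noteq> 0"
    and analytic: "\<nu>1 analytic_on {0}" "\<nu>2 analytic_on {0}"
    and roots: "\<forall>\<^sub>F z in nhds 0.
        (\<nu>1 z)\<^sup>2 - 2 * gam z * \<nu>1 z + 1 = 0 \<and> (\<nu>2 z)\<^sup>2 - 2 * gam z * \<nu>2 z + 1 = 0 \<and>
        norm (\<nu>1 z) < 1 \<and> 1 < norm (\<nu>2 z)"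
  shows "(\<lambda>z. denom z * (\<nu>1 z - \<nu>2 z)) has_fps_expansion kernel_fps a1 \<alpha> \<beta> \<delta>"
proof -
  let ?f = "\<lambda>z. denom z * (\<nu>1 z - \<nu>2 z)" and ?K = "kernel_fps a1 \<alpha> \<beta> \<delta> :: complex fps"
  define F where "F = fps_expansion ?f 0"
  have "?f analytic_on {0}"
    unfolding denom_def by (intro analytic_intros analytic)
  then have F: "?f has_fps_expansion F"
    unfolding F_def by (rule analytic_at_imp_has_fps_expansion_0)
  have vieta: "\<forall>\<^sub>F z in nhds 0. denom z \<noteq> 0 \<and> norm (\<nu>1 z) < norm (\<nu>2 z) \<and>
      denom z * (\<nu>1 z + \<nu>2 z) = 2 * (denom z + numer z) \<and> \<nu>1 z * \<nu>2 z = 1"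
    using roots denom_eventually_nonzero[OF assms(1)]
  proof eventually_elim
    case (elim z)
    then have "\<nu>1 z \<noteq> \<nu>2 z" by force
    moreover have "(\<nu>1 z - \<nu>2 z) * (\<nu>1 z + \<nu>2 z - 2 * gam z)
        = ((\<nu>1 z)\<^sup>2 - 2 * gam z * \<nu>1 z + 1) - ((\<nu>2 z)\<^sup>2 - 2 * gam z * \<nu>2 z + 1)"
      by (simp add: algebra_simps power2_eq_square)
    then have "(\<nu>1 z - \<nu>2 z) * (\<nu>1 z + \<nu>2 z - 2 * gam z) = 0"
      using elim by simp
    ultimately have sum: "\<nu>1 z + \<nu>2 z = 2 * gam z" by simp
    have "\<nu>1 z * (\<nu>1 z + \<nu>2 z) = (\<nu>1 z)\<^sup>2 + \<nu>1 z * \<nu>2 z"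
      by (simp add: algebra_simps power2_eq_square)
    with elim have "\<nu>1 z * \<nu>2 z = 1"
      unfolding sum by (simp add: algebra_simps)
    with elim sum show ?case
      by (auto simp: gam_def field_simps)
  qed
  have "\<forall>\<^sub>F z in nhds 0. ?f z * ?f z = 4 * numer z * (numer z + 2 * denom z)"
    using vieta
  proof eventually_elim
    case (elim z)
    have "?f z * ?f z = (denom z * (\<nu>1 z + \<nu>2 z))\<^sup>2 - 4 * (denom z)\<^sup>2 * (\<nu>1 z * \<nu>2 z)"
      by (simp add: algebra_simps power2_eq_square)
    also have "\<dots> = 4 * numer z * (numer z + 2 * denom z)"
      using elim by (simp add: algebra_simps power2_eq_square)
    finally show ?case .
  qed
  moreover have "(\<lambda>z. ?f z * ?f z) has_fps_expansion F * F"
    by (intro fps_expansion_intros F)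
  ultimately have "(\<lambda>z. 4 * numer z * (numer z + 2 * denom z)) has_fps_expansion F * F"
    by (subst (asm) has_fps_expansion_cong) auto
  moreover have "(\<lambda>z. 4 * numer z * (numer z + 2 * denom z)) has_fps_expansion ?K * ?K"
    unfolding kernel_fps_square_symbol numer_def denom_def lin_fps_def
    by (intro fps_expansion_intros)
  ultimately have "F * F = ?K * ?K"
    by (rule fps_expansion_unique_complex)
  then consider "F = ?K" | "F = - ?K"
    by (auto simp: square_eq_iff)
  then show ?thesis
  proof cases
    case 1
    then show ?thesis using F by simp
  next
    case 2
    define s where "s = a1 * sqrt \<delta>"
    have "s > 0"
      unfolding s_def by (rule sqrt_delta_pos)
    have "?f 0 = F $ 0"
      using has_fps_expansion_imp_0_eq_fps_nth_0[OF F] by simp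
    then have diff: "D0 * \<nu>1 0 - D0 * \<nu>2 0 = of_real (2 * s)"
      unfolding 2 by (simp add: kernel_fps_nth_0 denom_def s_def algebra_simps)
    have at_0: "D0 * \<nu>1 0 + D0 * \<nu>2 0 = of_real (2 * (D0 + n0))" "norm (\<nu>1 0) < norm (\<nu>2 0)"
      using eventually_nhds_x_imp_x[OF vieta] by (simp_all add: denom_def numer_def algebra_simps)
    have half: "2 * (D0 * \<nu>1 0) = 2 * of_real (D0 + n0 + s)" "2 * (D0 * \<nu>2 0) = 2 * of_real (D0 + n0 - s)"
      using arg_cong2[OF diff at_0(1), of "\<lambda>x y. y + x"] arg_cong2[OF diff at_0(1), of "\<lambda>x y. y - x"]
      by (simp_all add: algebra_simps)
    have "D0 * \<nu>1 0 = of_real (D0 + n0 + s)" "D0 * \<nu>2 0 = of_real (D0 + n0 - s)"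
      using half by (simp_all only: mult_cancel_left) simp_all
    moreover have "norm (D0 * \<nu>1 0) < norm (D0 * \<nu>2 0)"
      using at_0(2) assms(1) by (simp add: norm_mult)
    ultimately have "\<bar>D0 + n0 + s\<bar> < \<bar>D0 + n0 - s\<bar>"
      by (simp only: norm_of_real)
    then show ?thesis
      using \<open>s > 0\<close> n0_pos n0_2D0_pos by linarith
  qed
qed

text \<open>
  The principal square root of \<open>w\<close> is analytic near \<open>z = 0\<close>, where \<open>w = 1\<close>, so the quadratic formula
  gives analytic roots. Their product is \<open>1\<close>, hence the strict inequality of the moduli at \<open>0\<close>, which
  persists nearby, already separates them by the unit circle.
\<close>

lemma char_roots_exist:
  assumes "D0 \<noteq> 0"
  obtains \<nu>1 \<nu>2 where "\<nu>1 analytic_on {0}" "\<nu>2 analytic_on {0}"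
    "\<forall>\<^sub>F z in nhds 0.
        (\<nu>1 z)\<^sup>2 - 2 * gam z * \<nu>1 z + 1 = 0 \<and> (\<nu>2 z)\<^sup>2 - 2 * gam z * \<nu>2 z + 1 = 0 \<and>
        0 < norm (\<nu>1 z) \<and> norm (\<nu>1 z) < 1 \<and> 1 < norm (\<nu>2 z)"
proof -
  define s where "s = a1 * sqrt \<delta>"
  have "s > 0"
    unfolding s_def by (rule sqrt_delta_pos)
  define g where "g z = of_real s * csqrt (1 - of_real (2 * \<beta>) * z + of_real \<alpha> * (z * z))" for z
  define \<nu>1 where "\<nu>1 z = 1 + (numer z - g z) / denom z" for z
  define \<nu>2 where "\<nu>2 z = 1 + (numer z + g z) / denom z" for z
  have g_square: "g z * g z = numer z * (numer z + 2 * denom z)" for z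
  proof -
    have "g z * g z = of_real (s * s) * (csqrt (1 - of_real (2 * \<beta>) * z + of_real \<alpha> * (z * z)))\<^sup>2"
      unfolding g_def of_real_mult by (simp only: power2_eq_square mult_ac)
    also have "s * s = a1\<^sup>2 * \<delta>"
      using delta_pos by (simp add: s_def power2_eq_square)
    finally show ?thesis
      unfolding numer_def denom_def symbol_factorisation by simp
  qed
  have analytic: "\<nu>1 analytic_on {0}" "\<nu>2 analytic_on {0}"
    unfolding \<nu>1_def \<nu>2_def g_def numer_def denom_def using assms
    by (auto intro!: analytic_intros)
  have "of_real D0 * \<nu>1 0 = of_real (D0 + n0 - s)" "of_real D0 * \<nu>2 0 = of_real (D0 + n0 + s)"
    using assms by (simp_all add: \<nu>1_def \<nu>2_def numer_def denom_def g_def field_simps)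
  then have "norm (of_real D0 * \<nu>1 0) = \<bar>D0 + n0 - s\<bar>" "norm (of_real D0 * \<nu>2 0) = \<bar>D0 + n0 + s\<bar>"
    by (simp_all only: norm_of_real)
  then have "norm (of_real D0 * \<nu>1 0) < norm (of_real D0 * \<nu>2 0)"
    using \<open>s > 0\<close> n0_pos n0_2D0_pos by linarith
  then have at_0: "norm (\<nu>1 0) < norm (\<nu>2 0)"
    using assms by (simp add: norm_mult)
  have "isCont (\<lambda>z. norm (\<nu>2 z) - norm (\<nu>1 z)) 0"
    by (intro continuous_intros analytic_at_imp_isCont analytic)
  then have "\<forall>\<^sub>F z in at 0. norm (\<nu>2 z) - norm (\<nu>1 z) > 0"
    unfolding isCont_def using at_0 by (intro order_tendstoD) auto
  then have ev: "\<forall>\<^sub>F z in nhds 0. norm (\<nu>1 z) < norm (\<nu>2 z)"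
    using at_0 by (simp add: eventually_nhds_conv_at)
  have "\<forall>\<^sub>F z in nhds 0.
        (\<nu>1 z)\<^sup>2 - 2 * gam z * \<nu>1 z + 1 = 0 \<and> (\<nu>2 z)\<^sup>2 - 2 * gam z * \<nu>2 z + 1 = 0 \<and>
        0 < norm (\<nu>1 z) \<and> norm (\<nu>1 z) < 1 \<and> 1 < norm (\<nu>2 z)"
    using ev denom_eventually_nonzero[OF assms]
  proof eventually_elim
    case (elim z)
    have scaled: "denom z * \<nu>1 z = denom z + numer z - g z" "denom z * \<nu>2 z = denom z + numer z + g z"
        "denom z * gam z = denom z + numer z"
      using elim by (simp_all add: \<nu>1_def \<nu>2_def gam_def field_simps)
    have quadratic: "(denom z)\<^sup>2 * (\<nu>\<^sup>2 - 2 * gam z * \<nu> + 1)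
        = (denom z * \<nu>)\<^sup>2 - 2 * (denom z * gam z) * (denom z * \<nu>) + (denom z)\<^sup>2" for \<nu>
      by (simp add: algebra_simps power2_eq_square)
    have "(denom z)\<^sup>2 * ((\<nu>1 z)\<^sup>2 - 2 * gam z * \<nu>1 z + 1) = 0"
      "(denom z)\<^sup>2 * ((\<nu>2 z)\<^sup>2 - 2 * gam z * \<nu>2 z + 1) = 0"
      unfolding quadratic scaled using g_square[of z]
      by (simp_all add: algebra_simps power2_eq_square)
    then have equations: "(\<nu>1 z)\<^sup>2 - 2 * gam z * \<nu>1 z + 1 = 0" "(\<nu>2 z)\<^sup>2 - 2 * gam z * \<nu>2 z + 1 = 0"
      using elim by simp_all
    have "(denom z)\<^sup>2 * (\<nu>1 z * \<nu>2 z) = (denom z * \<nu>1 z) * (denom z * \<nu>2 z)"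
      by (simp add: power2_eq_square)
    also have "\<dots> = (denom z)\<^sup>2 * 1"
      unfolding scaled using g_square[of z] by (simp add: algebra_simps power2_eq_square)
    finally have "\<nu>1 z * \<nu>2 z = 1"
      using elim by simp
    then have product: "norm (\<nu>1 z) * norm (\<nu>2 z) = 1"
      by (simp flip: norm_mult)
    then have pos: "0 < norm (\<nu>1 z)" by auto
    have "norm (\<nu>1 z) < 1"
    proof (rule ccontr)
      assume "\<not> norm (\<nu>1 z) < 1"
      then have "1 * 1 < norm (\<nu>1 z) * norm (\<nu>2 z)"
        using elim by (intro mult_le_less_imp_less) auto
      with product show False by simp
    qed
    moreover have "1 < norm (\<nu>2 z)"
    proof (rule ccontr)
      assume "\<not> 1 < norm (\<nu>2 z)"
      then have "norm (\<nu>1 z) * norm (\<nu>2 z) < 1 * 1"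
        using elim pos by (intro mult_less_le_imp_less) auto
      with product show False by simp
    qed
    ultimately show ?case
      using equations pos by blast
  qed
  with analytic show thesis
    by (rule that)
qed

end

section \<open>The formal far field in the critical case\<close>

text \<open>
  The series \<open>M = 2 (D + N) - K\<close> and \<open>2 (D + N) + K\<close> play the parts of \<open>2 d \<nu>2\<close> and \<open>2 d \<nu>1\<close>, and their
  product is \<open>4 D\<^sup>2\<close>. Only the former is a unit when \<open>D(0) = 0\<close>, so \<open>\<nu> = 2 D / M\<close> stands for \<open>\<nu>1 = 1 / \<nu>2\<close>.
  Because \<open>\<nu>(0) = 0\<close>, a nonzero defect \<open>V\<^sub>j\<^sub>+\<^sub>1 - \<nu> V\<^sub>j\<close> would have an order of vanishing that drops
  forever as \<open>j\<close> grows, so \<open>V\<^sub>j = \<nu>\<^sup>j V\<^sub>0\<close> is the only solution.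
\<close>

lemma transparent_relation_fps:
  fixes N D K :: "'a::field_char_0 fps"
  assumes K_square: "K * K = 4 * N * (N + 2 * D)"
    and D_0: "D $ 0 = 0"
    and unit: "(2 * (D + N) - K) $ 0 \<noteq> 0"
    and recurrence: "\<And>j. D * V (Suc (Suc j)) = 2 * (D + N) * V (Suc j) - D * V j"
  shows "D * (V 2 - V 0) = K * V 1"
proof -
  define M where "M = 2 * (D + N) - K"
  define \<nu> where "\<nu> = 2 * D * inverse M"
  have "M \<noteq> 0"
    using unit by (auto simp: M_def)
  have M_nu: "M * \<nu> = 2 * D"
    using inverse_mult_eq_1'[of M] unit by (simp add: M_def \<nu>_def mult.left_commute)
  have "M * (2 * D * \<nu>) = 2 * D * (M * \<nu>)"
    by (simp add: mult_ac)
  also have "\<dots> = 4 * (D * D)"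
    unfolding M_nu by simp
  also have "\<dots> = 4 * (D + N) * (D + N) - K * K"
    unfolding K_square by (simp add: algebra_simps)
  also have "\<dots> = M * (2 * (D + N) + K)"
    by (simp add: M_def algebra_simps)
  finally have D_nu: "2 * D * \<nu> = 2 * (D + N) + K"
    using \<open>M \<noteq> 0\<close> by simp
  define e where "e j = V (Suc j) - \<nu> * V j" for j
  \<comment> \<open>The recurrence is \<open>(S - \<nu>2) (S - \<nu>1) V = 0\<close> for the shift \<open>S\<close>, that is \<open>S e = \<nu>2 e\<close>.\<close>
  have e_step: "e j = \<nu> * e (Suc j)" for j
  proof -
    have "M * (\<nu> * e (Suc j)) = 2 * (D * V (Suc (Suc j))) - 2 * D * \<nu> * V (Suc j)"
      unfolding mult.assoc[symmetric] M_nu by (simp add: e_def algebra_simps)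
    also have "\<dots> = M * V (Suc j) - 2 * D * V j"
      unfolding recurrence D_nu by (simp add: M_def algebra_simps)
    also have "\<dots> = M * e j"
      unfolding M_nu[symmetric] by (simp add: e_def algebra_simps)
    finally show ?thesis
      using \<open>M \<noteq> 0\<close> by simp
  qed
  have e_power: "e j = \<nu> ^ k * e (j + k)" for j k
  proof (induction k)
    case (Suc k)
    then show ?case
      using e_step[of "j + k"] by (simp add: mult_ac)
  qed simp
  have "\<nu> $ 0 = 0"
    using D_0 by (simp add: \<nu>_def)
  have "e j = 0" for j
  proof (rule fps_ext)
    fix i
    \<comment> \<open>\<open>\<nu>\<^sup>k\<close> has no term of degree below \<open>k\<close>; the power \<open>k = i + 1\<close> settles degree \<open>i\<close>.\<close>
    have "e j $ i = (\<Sum>q=0..i. (\<nu> ^ Suc i) $ q * e (j + Suc i) $ (i - q))"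
      by (subst e_power[of j "Suc i"]) (rule fps_mult_nth)
    also have "\<dots> = 0"
      using startsby_zero_power_prefix[OF \<open>\<nu> $ 0 = 0\<close>, of "Suc i"] by (intro sum.neutral) auto
    finally show "e j $ i = 0 $ i" by simp
  qed
  then have V_Suc: "V (Suc j) = \<nu> * V j" for j
    by (simp add: e_def)
  have "2 * (D * (V 2 - V 0)) = 2 * D * \<nu> * V 1 - M * (\<nu> * V 0)"
    unfolding mult.assoc[symmetric] M_nu using V_Suc[of 1] by (simp add: algebra_simps numeral_2_eq_2)
  also have "\<dots> = 2 * (K * V 1)"
    unfolding D_nu V_Suc[symmetric] by (simp add: M_def algebra_simps)
  finally show ?thesis by simp
qed

section \<open>The scheme beyond the artificial boundary\<close>

lemma C_op_uniform:
  assumes "mesh_step x j = h" "mesh_step x (Suc j) = h" "h > 0" "\<kappa> j = k" "\<kappa> (Suc j) = k"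
  shows "C_op x \<theta> \<kappa> W j = k * (\<theta> * W (j - 1) + (1 - 2 * \<theta>) * W j + \<theta> * W (Suc j))"
  using assms by (simp add: C_op_def sx_hat_def mesh_half_step_def field_simps)

lemma A_op_uniform:
  assumes "mesh_step x j = h" "mesh_step x (Suc j) = h" "h > 0"
    and "bh j = b" "bh (Suc j) = b" "ch j = c" "ch (Suc j) = c"
  shows "A_op x \<theta> bh ch W j
    = - b * (W (Suc j) - 2 * W j + W (j - 1)) / h\<^sup>2
      + c * (\<theta> * W (j - 1) + (1 - 2 * \<theta>) * W j + \<theta> * W (Suc j))"
proof -
  have "dx_hat x (\<lambda>i. bh i * dx_bar x W i) j = b * (W (Suc j) - 2 * W j + W (j - 1)) / h\<^sup>2"
    using assms by (simp add: dx_hat_def dx_bar_def mesh_half_step_def field_simps power2_eq_square)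
  then show ?thesis
    using C_op_uniform[of x j h ch c \<theta> W] assms by (simp add: A_op_def)
qed

locale transparent_bc_params =
  fixes \<rho>_inf b_inf c_inf h \<tau> \<sigma> \<theta> a0 a1 d0 d1 \<alpha>0 \<alpha>1 \<alpha> \<beta> \<delta> :: real
  assumes pos: "\<rho>_inf > 0" "b_inf > 0" "c_inf \<ge> 0" "h > 0" "\<tau> > 0" "\<sigma> > 0"
    and theta: "\<theta> \<le> 1 / 4"
    and a1_def: "a1 = h\<^sup>2 * \<rho>_inf / (2 * \<tau> * b_inf)"
    and a0_def: "a0 = h\<^sup>2 * c_inf / (2 * b_inf)"
    and d0_def: "d0 = a0 / a1"
    and d1_def: "d1 = 2 / a1"
    and \<alpha>0_def: "\<alpha>0 = 1 - d0 / (1 + \<sigma> * d0)"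
    and \<alpha>1_def: "\<alpha>1 = 1 - (d0 * (1 - 4 * \<theta>) + d1) / ((1 + \<sigma> * d0) * (1 - 4 * \<theta>) + \<sigma> * d1)"
    and \<alpha>_def: "\<alpha> = \<alpha>0 * \<alpha>1"
    and \<beta>_def: "\<beta> = (\<alpha>0 + \<alpha>1) / 2"
    and \<delta>_def: "\<delta> = (1 + \<sigma> * d0) * ((1 + \<sigma> * d0) * (1 - 4 * \<theta>) + \<sigma> * d1)"
begin

lemma a1_pos: "a1 > 0" and a0_nonneg: "a0 \<ge> 0"
  using pos by (simp_all add: a1_def a0_def)

lemma d0_nonneg: "d0 \<ge> 0" and d1_pos: "d1 > 0"
  using a1_pos a0_nonneg by (simp_all add: d0_def d1_def)

lemma linear_factor_pos: "1 + \<sigma> * d0 > 0" "(1 + \<sigma> * d0) * (1 - 4 * \<theta>) + \<sigma> * d1 > 0"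
proof -
  show u: "1 + \<sigma> * d0 > 0"
    using pos d0_nonneg by (simp add: add_pos_nonneg)
  show "(1 + \<sigma> * d0) * (1 - 4 * \<theta>) + \<sigma> * d1 > 0"
    using u theta pos d1_pos by (intro add_nonneg_pos mult_nonneg_nonneg) auto
qed

definition n0 where "n0 = a1 + a0 * \<sigma>"
definition n1 where "n1 = a0 * (1 - \<sigma>) - a1"
definition D0 where "D0 = (1 - 2 * a0 * \<theta>) * \<sigma> - 2 * a1 * \<theta>"
definition D1 where "D1 = 2 * a1 * \<theta> + (1 - 2 * a0 * \<theta>) * (1 - \<sigma>)"

text \<open>
  With \<open>u = 1 + \<sigma> d0\<close> and \<open>E = (1 + \<sigma> d0) (1 - 4 \<theta>) + \<sigma> d1\<close> the factors are
  \<open>n = a1 u (1 - \<alpha>0 z)\<close> and \<open>n + 2 d = a1 E (1 - \<alpha>1 z)\<close>, while \<open>\<delta> = u E\<close>.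
\<close>

sublocale factored_symbol n0 n1 D0 D1 a1 \<alpha> \<beta> \<delta>
proof -
  define u where "u = 1 + \<sigma> * d0"
  define E where "E = (1 + \<sigma> * d0) * (1 - 4 * \<theta>) + \<sigma> * d1"
  have uE: "u > 0" "E > 0"
    using linear_factor_pos by (simp_all add: u_def E_def)
  have a0: "a0 = a1 * d0" and two: "2 = a1 * d1"
    using a1_pos by (simp_all add: d0_def d1_def)
  have n: "n0 = a1 * u" "n1 = - (a1 * u * \<alpha>0)"
    unfolding n0_def n1_def \<alpha>0_def using uE
    by (simp_all add: a0 u_def field_simps)
  have "n0 + 2 * D0 = a1 * (u * (1 - 4 * \<theta>)) + 2 * \<sigma>"
    unfolding n0_def D0_def by (simp add: a0 u_def algebra_simps)
  also have "\<dots> = a1 * E"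
    unfolding two by (simp add: E_def u_def algebra_simps)
  finally have nD0: "n0 + 2 * D0 = a1 * E" .
  have "n1 + 2 * D1 = - (a1 * ((u - d0) * (1 - 4 * \<theta>))) + 2 * (1 - \<sigma>)"
    unfolding n1_def D1_def by (simp add: a0 u_def algebra_simps)
  also have "\<dots> = - (a1 * (E - (d0 * (1 - 4 * \<theta>) + d1)))"
    unfolding two by (simp add: E_def u_def algebra_simps)
  also have "\<dots> = - (a1 * E * \<alpha>1)"
    using uE unfolding \<alpha>1_def E_def[symmetric] by (simp add: right_diff_distrib)
  finally have nD1: "n1 + 2 * D1 = - (a1 * E * \<alpha>1)" .
  have delta: "\<delta> = u * E"
    by (simp add: \<delta>_def u_def E_def)
  show "factored_symbol n0 n1 D0 D1 a1 \<alpha> \<beta> \<delta>"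
  proof
    show "n0 * (n0 + 2 * D0) = a1\<^sup>2 * \<delta>"
      unfolding nD0 unfolding n delta by (simp add: power2_eq_square)
    show "n0 * (n1 + 2 * D1) + n1 * (n0 + 2 * D0) = - 2 * \<beta> * (a1\<^sup>2 * \<delta>)"
      unfolding nD0 nD1 unfolding n delta \<beta>_def by (simp add: power2_eq_square field_simps)
    show "n1 * (n1 + 2 * D1) = \<alpha> * (a1\<^sup>2 * \<delta>)"
      unfolding nD1 unfolding n delta \<alpha>_def by (simp add: power2_eq_square)
    show "n0 + 2 * D0 > 0" unfolding nD0 using uE a1_pos by simp
    show "n0 > 0" unfolding n using uE a1_pos by simp
    show "\<delta> > 0" unfolding delta using uE by simp
    show "a1 > 0" by (rule a1_pos)
  qed
qed

lemma denom_eq_d_fun: "denom = d_fun a0 a1 \<sigma> \<theta>"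
  unfolding denom_def d_fun_def z_sig_def unfolding D0_def D1_def by (rule ext) (simp add: algebra_simps)

lemma gam_eq_gamma_fun: "gam = gamma_fun a0 a1 \<sigma> \<theta>"
proof
  fix z
  have "numer z = of_real a1 * (1 - z) + of_real a0 * z_sig \<sigma> z"
    unfolding numer_def z_sig_def unfolding n0_def n1_def by (simp add: algebra_simps)
  then show "gam z = gamma_fun a0 a1 \<sigma> \<theta> z"
    by (simp add: gam_def gamma_fun_def denom_eq_d_fun)
qed

text \<open>
  The quantity differentiated in the transparent boundary condition has the symbol
  \<open>z\<^bsup>(\<sigma>)\<^esup> - 2 \<theta> n = d\<close>; here \<open>u\<close> and \<open>v\<close> are the values at the new and the old time level.
\<close>

lemma flux_coefficients:
  "(\<sigma> * u + (1 - \<sigma>) * v)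
     - \<theta> * h\<^sup>2 / b_inf * (\<rho>_inf * ((u - v) / \<tau>) + c_inf * (\<sigma> * u + (1 - \<sigma>) * v))
   = D0 * u + D1 * v"
proof -
  have "\<theta> * h\<^sup>2 / b_inf * (\<rho>_inf * ((u - v) / \<tau>) + c_inf * (\<sigma> * u + (1 - \<sigma>) * v))
      = 2 * a1 * \<theta> * (u - v) + 2 * a0 * \<theta> * (\<sigma> * u + (1 - \<sigma>) * v)"
    using pos by (simp add: a1_def a0_def field_simps)
  then show ?thesis
    by (simp add: D0_def D1_def algebra_simps)
qed

text \<open>
  The weighted average is \<open>W\<^sub>j + \<theta> \<Delta>W\<^sub>j\<close>, where \<open>\<Delta>\<close> is the second difference. After scaling by
  \<open>h\<^sup>2 / (2 b_inf)\<close> the scheme therefore has the symbol \<open>n + (\<theta> n - z\<^bsup>(\<sigma>)\<^esup> / 2) \<Delta>\<close>, and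
  \<open>z\<^bsup>(\<sigma>)\<^esup> - 2 \<theta> n = d\<close> turns this into \<open>n - d \<Delta> / 2\<close>.
\<close>

lemma far_field_recurrence:
  assumes steps: "mesh_step x j = h" "mesh_step x (Suc j) = h"
    and coeffs: "\<And>i. i \<in> {j, Suc j} \<Longrightarrow> \<rho>h i = \<rho>_inf \<and> bh i = b_inf \<and> ch i = c_inf"
    and scheme: "C_op x \<theta> \<rho>h (dt_bar \<tau> U m) j + A_op x \<theta> bh ch (t_avg \<sigma> U m) j = 0"
  shows "D0 * U m (Suc j) + D1 * U (m - 1) (Suc j)
    = 2 * ((D0 + n0) * U m j + (D1 + n1) * U (m - 1) j) - (D0 * U m (j - 1) + D1 * U (m - 1) (j - 1))"
proof -
  let ?T = "dt_bar \<tau> U m" and ?S = "t_avg \<sigma> U m"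
  let ?avg = "\<lambda>W. \<theta> * W (j - 1) + (1 - 2 * \<theta>) * W j + \<theta> * W (Suc j) :: real"
  have "\<rho>_inf * ?avg ?T + (- b_inf * (?S (Suc j) - 2 * ?S j + ?S (j - 1)) / h\<^sup>2 + c_inf * ?avg ?S) = 0"
    using scheme coeffs steps pos
    by (simp add: C_op_uniform[of x j h \<rho>h \<rho>_inf] A_op_uniform[of x j h bh b_inf ch c_inf])
  then have "0 = h\<^sup>2 / b_inf
      * (\<rho>_inf * ?avg ?T + (- b_inf * (?S (Suc j) - 2 * ?S j + ?S (j - 1)) / h\<^sup>2 + c_inf * ?avg ?S))"
    by simp
  also have "\<dots> = 2 * a1 * (\<tau> * ?avg ?T) + 2 * a0 * ?avg ?S - (?S (Suc j) - 2 * ?S j + ?S (j - 1))"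
    using pos by (simp add: a1_def a0_def field_simps)
  also have "\<tau> * ?avg ?T = ?avg (\<lambda>i. U m i - U (m - 1) i)"
    using pos by (simp add: dt_bar_def field_simps)
  finally have "2 * a1 * ?avg (\<lambda>i. U m i - U (m - 1) i) + 2 * a0 * ?avg ?S
      - (?S (Suc j) - 2 * ?S j + ?S (j - 1)) = 0"
    by simp
  then show ?thesis
    by (simp add: t_avg_def n0_def n1_def D0_def D1_def algebra_simps)
qed

text \<open>
  The formal argument applies from node \<open>J - 1\<close> on: \<open>h\<^sub>J \<le> X - X0\<close> puts the node \<open>J - 1\<close> into the region
  of constant coefficients, and since the initial data vanish there, the generating series in time
  start with degree \<open>1\<close>, so that the scheme becomes a recurrence between whole series.
\<close>

lemma transparent_bc_critical:
  assumes D0: "D0 = 0"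
    and X0: "0 < X0" "X0 < X"
    and coeffs: "admissible_coeffs \<rho>_inf b_inf c_inf X0 \<rho> b c"
    and mesh: "admissible_mesh h X0 X x J"
    and scheme: "scheme_solution x J \<tau> \<sigma> \<theta> \<rho> b c F U0 U"
    and m: "m \<ge> 1"
  shows "dx_circ x (\<lambda>j. t_avg \<sigma> U m j
      - \<theta> * h\<^sup>2 / b_inf * (\<rho>_inf * dt_bar \<tau> U m j + c_inf * t_avg \<sigma> U m j)) J
    = S_ref h (ref_kernel a1 \<alpha> \<beta> \<delta>) m (\<lambda>n. U n J)"
proof -
  have nodes: "x 0 = 0" "strict_mono x" "x J = X" "mesh_step x J \<le> X - X0"
    and uniform: "\<And>j. j \<ge> J \<Longrightarrow> mesh_step x j = h"
    using mesh by (auto simp: admissible_mesh_def)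
  have "x 0 < x J"
    using nodes X0 by simp
  then have "J \<noteq> 0" by (intro notI) simp
  then obtain k where J: "J = Suc k"
    using not0_implies_Suc by blast
  have far: "mesh_coeff x \<rho> j = \<rho>_inf \<and> mesh_coeff x b j = b_inf \<and> mesh_coeff x c j = c_inf"
    if "j \<ge> J" for j
  proof -
    have "X0 \<le> x k"
      using nodes by (simp add: J mesh_step_def)
    also have "x k \<le> x (j - 1)"
      using that nodes(2) J by (simp add: strict_mono_less_eq)
    finally have "X0 \<le> x (j - 1)" .
    moreover have "x (j - 1) \<le> x j"
      using nodes(2) by (simp add: strict_mono_less_eq)
    ultimately have "X0 \<le> (x (j - 1) + x j) / 2" by simp
    then show ?thesis
      using coeffs by (simp add: admissible_coeffs_def mesh_coeff_def)
  qed
  have initial: "U 0 j = 0" if "j \<ge> k" for j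
    using scheme that by (simp add: scheme_solution_def J)
  have recurrence: "D0 * U n (Suc j) + D1 * U (n - 1) (Suc j)
    = 2 * ((D0 + n0) * U n j + (D1 + n1) * U (n - 1) j) - (D0 * U n (j - 1) + D1 * U (n - 1) (j - 1))"
    if "j \<ge> J" "n \<ge> 1" for j n
  proof (rule far_field_recurrence)
    show "C_op x \<theta> (mesh_coeff x \<rho>) (dt_bar \<tau> U n) j
        + A_op x \<theta> (mesh_coeff x b) (mesh_coeff x c) (t_avg \<sigma> U n) j = 0"
      using scheme that J by (simp add: scheme_solution_def)
  qed (use that uniform far in auto)
  define V where "V j = Abs_fps (\<lambda>n. U n (k + j))" for j
  let ?N = "lin_fps n0 n1 :: real fps" and ?D = "lin_fps D0 D1 :: real fps"
    and ?K = "kernel_fps a1 \<alpha> \<beta> \<delta> :: real fps"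
  have V_nth: "V j $ n = U n (k + j)" for j n
    by (simp add: V_def)
  have V_0: "V j $ 0 = 0" for j
    by (simp add: V_nth initial)
  have "?D * (V 2 - V 0) = ?K * V 1"
  proof (rule transparent_relation_fps[where N = ?N])
    show "?K * ?K = 4 * ?N * (?N + 2 * ?D)"
      by (rule kernel_fps_square_symbol)
    show "?D $ 0 = 0"
      by (simp add: lin_fps_nth_0 D0)
    have "(2 * (?D + ?N) - ?K) $ 0 = 2 * n0 + 2 * (a1 * sqrt \<delta>)"
      by (simp add: lin_fps_nth_0 kernel_fps_nth_0 D0)
    then show "(2 * (?D + ?N) - ?K) $ 0 \<noteq> 0"
      using n0_pos sqrt_delta_pos by simp
    fix j
    show "?D * V (Suc (Suc j)) = 2 * (?D + ?N) * V (Suc j) - ?D * V j"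
    proof (rule fps_ext)
      fix n
      have sum: "2 * (?D + ?N) * V (Suc j)
          = (?D * V (Suc j) + ?N * V (Suc j)) + (?D * V (Suc j) + ?N * V (Suc j))"
        by (simp add: algebra_simps)
      show "(?D * V (Suc (Suc j))) $ n = (2 * (?D + ?N) * V (Suc j) - ?D * V j) $ n"
      proof (cases "n = 0")
        case True
        then show ?thesis
          unfolding sum by (simp add: V_0)
      next
        case False
        then have nth: "(lin_fps u v * V i) $ n = u * U n (k + i) + v * U (n - 1) (k + i)" for u v i
          by (simp add: lin_fps_mult_nth V_nth)
        show ?thesis
          unfolding sum fps_sub_nth fps_add_nth nth
          using recurrence[of "Suc (k + j)" n] False by (simp add: J algebra_simps)
      qed
    qed
  qed
  then have "(?D * V 2) $ m - (?D * V 0) $ m = (?K * V 1) $ m"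
    by (simp add: right_diff_distrib flip: fps_sub_nth)
  then have relation: "(D0 * U m (J + 1) + D1 * U (m - 1) (J + 1)) - (D0 * U m (J - 1) + D1 * U (m - 1) (J - 1))
      = (\<Sum>q\<le>m. ref_kernel a1 \<alpha> \<beta> \<delta> q * U (m - q) J)"
    using m by (simp add: lin_fps_mult_nth V_nth J fps_mult_nth[of "Abs_fps (ref_kernel a1 \<alpha> \<beta> \<delta>)"] kernel_fps_def atLeast0AtMost)
  have half_step: "mesh_half_step x J = h"
    using uniform by (simp add: mesh_half_step_def)
  show ?thesis
    unfolding dx_circ_def S_ref_def half_step relation[symmetric]
    unfolding t_avg_def dt_bar_def flux_coefficients by simp
qed

end

theorem proposition7:
  fixes \<rho>_inf b_inf c_inf h \<tau> \<sigma> \<theta> a0 a1 \<sigma>0 d0 d1 \<alpha>0 \<alpha>1 \<alpha> \<beta> \<delta> :: real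
  assumes "\<rho>_inf > 0" "b_inf > 0" "c_inf \<ge> 0" "h > 0" "\<tau> > 0"
    and "a1 = h\<^sup>2 * \<rho>_inf / (2 * \<tau> * b_inf)"
    and "a0 = h\<^sup>2 * c_inf / (2 * b_inf)"
    and "\<sigma>0 = 2 * a1 * \<theta> / (1 - 2 * a0 * \<theta>)"
    and "d0 = a0 / a1"
    and "d1 = 2 / a1"
    and "\<alpha>0 = 1 - d0 / (1 + \<sigma> * d0)"
    and "\<alpha>1 = 1 - (d0 * (1 - 4 * \<theta>) + d1) / ((1 + \<sigma> * d0) * (1 - 4 * \<theta>) + \<sigma> * d1)"
    and "\<alpha> = \<alpha>0 * \<alpha>1"
    and "\<beta> = (\<alpha>0 + \<alpha>1) / 2"
    and "\<delta> = (1 + \<sigma> * d0) * ((1 + \<sigma> * d0) * (1 - 4 * \<theta>) + \<sigma> * d1)"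
    and "\<theta> \<le> 1 / 4"
    and "(\<sigma> > 0 \<and> \<sigma> \<noteq> \<sigma>0) \<or> (\<sigma> = \<sigma>0 \<and> \<sigma>0 \<ge> 1 / 2)"
  shows "d0 = c_inf / \<rho>_inf * \<tau> \<and> d0 \<ge> 0 \<and> d1 = 4 * (b_inf / \<rho>_inf) * (\<tau> / h\<^sup>2) \<and> d1 > 0 \<and> \<delta> > 0 \<and>
    (\<sigma> \<noteq> \<sigma>0 \<longrightarrow>
       (\<exists>\<nu>1 \<nu>2. char_roots a0 a1 \<sigma> \<theta> \<nu>1 \<nu>2) \<and>
       (\<forall>\<nu>1 \<nu>2. char_roots a0 a1 \<sigma> \<theta> \<nu>1 \<nu>2 \<longrightarrow>
          (\<lambda>z. d_fun a0 a1 \<sigma> \<theta> z * (\<nu>1 z - \<nu>2 z))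
            has_fps_expansion Abs_fps (\<lambda>m. complex_of_real (ref_kernel a1 \<alpha> \<beta> \<delta> m)))) \<and>
    (\<sigma> = \<sigma>0 \<longrightarrow>
       (\<forall>X0 X \<rho> b c x J F U0 U.
          0 < X0 \<and> X0 < X \<and>
          admissible_coeffs \<rho>_inf b_inf c_inf X0 \<rho> b c \<and>
          admissible_mesh h X0 X x J \<and>
          scheme_solution x J \<tau> \<sigma> \<theta> \<rho> b c F U0 U \<longrightarrow>
          (\<forall>m\<ge>1.
             dx_circ x (\<lambda>j. t_avg \<sigma> U m j
               - \<theta> * h\<^sup>2 / b_inf * (\<rho>_inf * dt_bar \<tau> U m j + c_inf * t_avg \<sigma> U m j)) J
             = S_ref h (ref_kernel a1 \<alpha> \<beta> \<delta>) m (\<lambda>n. U n J))))"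
proof -
  have sigma_pos: "\<sigma> > 0"
    using assms(17) by auto
  interpret transparent_bc_params \<rho>_inf b_inf c_inf h \<tau> \<sigma> \<theta> a0 a1 d0 d1 \<alpha>0 \<alpha>1 \<alpha> \<beta> \<delta>
    using assms sigma_pos by unfold_locales
  \<comment> \<open>The convention \<open>x / 0 = 0\<close> makes \<open>\<sigma>0 = 0 < \<sigma>\<close> when \<open>2 a0 \<theta> = 1\<close>, in agreement with \<open>d(0) \<noteq> 0\<close>.\<close>
  have D0_iff: "D0 = 0 \<longleftrightarrow> \<sigma> = \<sigma>0"
  proof (cases "1 - 2 * a0 * \<theta> = 0")
    case True
    then have "\<theta> \<noteq> 0" by auto
    then show ?thesis
      unfolding D0_def assms(8) using True a1_pos sigma_pos by simp
  next
    case False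
    then show ?thesis
      unfolding D0_def assms(8) by (auto simp: field_simps)
  qed
  have "d0 = c_inf / \<rho>_inf * \<tau>" "d1 = 4 * (b_inf / \<rho>_inf) * (\<tau> / h\<^sup>2)"
    unfolding assms(6,7,9,10) using assms(1-5) by (simp_all add: field_simps)
  moreover have "(\<exists>\<nu>1 \<nu>2. char_roots a0 a1 \<sigma> \<theta> \<nu>1 \<nu>2) \<and>
       (\<forall>\<nu>1 \<nu>2. char_roots a0 a1 \<sigma> \<theta> \<nu>1 \<nu>2 \<longrightarrow>
          (\<lambda>z. d_fun a0 a1 \<sigma> \<theta> z * (\<nu>1 z - \<nu>2 z))
            has_fps_expansion Abs_fps (\<lambda>m. complex_of_real (ref_kernel a1 \<alpha> \<beta> \<delta> m)))" if "\<sigma> \<noteq> \<sigma>0"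
  proof (intro conjI allI impI)
    have "D0 \<noteq> 0"
      using that D0_iff by simp
    obtain \<mu>1 \<mu>2 where "\<mu>1 analytic_on {0}" "\<mu>2 analytic_on {0}"
      "\<forall>\<^sub>F z in nhds 0.
        (\<mu>1 z)\<^sup>2 - 2 * gam z * \<mu>1 z + 1 = 0 \<and> (\<mu>2 z)\<^sup>2 - 2 * gam z * \<mu>2 z + 1 = 0 \<and>
        0 < norm (\<mu>1 z) \<and> norm (\<mu>1 z) < 1 \<and> 1 < norm (\<mu>2 z)"
      using \<open>D0 \<noteq> 0\<close> by (rule char_roots_exist)
    then have "char_roots a0 a1 \<sigma> \<theta> \<mu>1 \<mu>2"
      unfolding char_roots_def gam_eq_gamma_fun by (intro conjI)
    then show "\<exists>\<nu>1 \<nu>2. char_roots a0 a1 \<sigma> \<theta> \<nu>1 \<nu>2"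
      by (intro exI)
    fix \<nu>1 \<nu>2
    assume roots: "char_roots a0 a1 \<sigma> \<theta> \<nu>1 \<nu>2"
    have "\<forall>\<^sub>F z in nhds 0.
        (\<nu>1 z)\<^sup>2 - 2 * gam z * \<nu>1 z + 1 = 0 \<and> (\<nu>2 z)\<^sup>2 - 2 * gam z * \<nu>2 z + 1 = 0 \<and>
        norm (\<nu>1 z) < 1 \<and> 1 < norm (\<nu>2 z)"
      using roots unfolding char_roots_def gam_eq_gamma_fun by (auto elim: eventually_mono)
    then show "(\<lambda>z. d_fun a0 a1 \<sigma> \<theta> z * (\<nu>1 z - \<nu>2 z))
        has_fps_expansion Abs_fps (\<lambda>m. complex_of_real (ref_kernel a1 \<alpha> \<beta> \<delta> m))"
      using char_roots_expansion[OF \<open>D0 \<noteq> 0\<close>, of \<nu>1 \<nu>2] roots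
      by (simp add: char_roots_def denom_eq_d_fun kernel_fps_def)
  qed
  moreover have "dx_circ x (\<lambda>j. t_avg \<sigma> U m j
      - \<theta> * h\<^sup>2 / b_inf * (\<rho>_inf * dt_bar \<tau> U m j + c_inf * t_avg \<sigma> U m j)) J
    = S_ref h (ref_kernel a1 \<alpha> \<beta> \<delta>) m (\<lambda>n. U n J)"
    if "\<sigma> = \<sigma>0" and "0 < X0 \<and> X0 < X \<and>
          admissible_coeffs \<rho>_inf b_inf c_inf X0 \<rho> b c \<and>
          admissible_mesh h X0 X x J \<and>
          scheme_solution x J \<tau> \<sigma> \<theta> \<rho> b c F U0 U" and "m \<ge> 1"
    for X0 X \<rho> b c x J F U0 U m
    using that D0_iff by (intro transparent_bc_critical[of X0 X \<rho> b c x J F U0 U m]) simp_all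
  ultimately show ?thesis
    using d0_nonneg d1_pos delta_pos by (intro conjI impI allI) simp_all
qed

end
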